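(* Let $k\ge 0$ be an integer and let $\{S^{(k)}_n\}$ be the $k$-Skipponacci numbers. Every integer $x\in\mathbb{Z}$ has a unique far-difference representation by the $k$-Skipponacci numbers in which every two terms of the same sign are at least $2k+2$ apart in index and every two terms of opposite sign are at least $k+2$ apart in index.
   Context: The $k$-Skipponacci numbers are defined by $S^{(k)}_n=0$ for $n\le 0$, $S^{(k)}_i=i$ for $1\le i\le k+1$, and $S^{(k)}_{n+1}=S^{(k)}_n+S^{(k)}_{n-k}$ for $n\ge k+1$ (so $k=0$ gives powers of $2$ and $k=1$ gives the Fibonacci numbers $1,2,3,5,8,\dots$). A far-difference representation of $x$ is an expression $x=\sum_{t}\epsilon_t S^{(k)}_{n_t}$ with $\epsilon_t\in\{-1,+1\}$ and distinct indices $n_t\ge 1$; the integer $0$ is represented by the empty sum. *)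

theory Defs
  imports Main
begin

text \<open>Indices are natural numbers: the values at negative indices (all zero) enter neither the
  recurrence, which is only used for \<open>n \<ge> k + 1\<close>, nor a representation, whose indices are
  positive. The first case covers both \<open>S\<^sub>0 = 0\<close> and \<open>S\<^sub>i = i\<close> for \<open>1 \<le> i \<le> k + 1\<close>.\<close>

function skipponacci :: "nat \<Rightarrow> nat \<Rightarrow> int" where
  "skipponacci k n =
     (if n \<le> k + 1 then int n else skipponacci k (n - 1) + skipponacci k (n - 1 - k))"
  by auto
termination by (relation "measure snd") auto

declare skipponacci.simps [simp del]

lemma skipponacci_0: "skipponacci k 0 = 0"
  by (simp add: skipponacci.simps)

lemma skipponacci_init: "1 \<le> i \<Longrightarrow> i \<le> k + 1 \<Longrightarrow> skipponacci k i = int i"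
  by (simp add: skipponacci.simps)

lemma skipponacci_rec:
  "n \<ge> k + 1 \<Longrightarrow> skipponacci k (n + 1) = skipponacci k n + skipponacci k (n - k)"
  by (subst skipponacci.simps) simp

text \<open>A representation is its finite set of signed terms: \<open>(\<epsilon>, n)\<close> stands for \<open>\<epsilon> S\<^sub>n\<close>.
  Injectivity of \<^term>\<open>snd\<close> says that the indices of distinct terms are distinct.\<close>

definition far_difference_rep :: "nat \<Rightarrow> int \<Rightarrow> (int \<times> nat) set \<Rightarrow> bool" where
  "far_difference_rep k x R \<longleftrightarrow>
     finite R \<and> (\<forall>(\<epsilon>, n) \<in> R. \<epsilon> \<in> {-1, 1} \<and> n \<ge> 1) \<and> inj_on snd R \<and>
     x = (\<Sum>(\<epsilon>, n) \<in> R. \<epsilon> * skipponacci k n)"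

definition well_spaced :: "nat \<Rightarrow> (int \<times> nat) set \<Rightarrow> bool" where
  "well_spaced k R \<longleftrightarrow>
     (\<forall>(\<epsilon>, m) \<in> R. \<forall>(\<delta>, n) \<in> R. m < n \<longrightarrow>
        (\<epsilon> = \<delta> \<longrightarrow> m + (2 * k + 2) \<le> n) \<and> (\<epsilon> \<noteq> \<delta> \<longrightarrow> m + (k + 2) \<le> n))"

end

theory Submission
  imports Defs
begin

text \<open>Let \<open>M n = S n + S (n - (2k+2)) + S (n - 2(2k+2)) + \<dots>\<close> be the largest number
  represented with indices at most \<open>n\<close>. The identity \<open>S n = M (n-1) + M (n-k-2) + 1\<close> shows that
  a representation with leading term \<open>\<epsilon> S n\<close> has a value \<open>x\<close> with \<open>M (n-1) < \<epsilon> x \<le> M n\<close>. These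
  intervals partition the positive integers, so \<open>x\<close> determines its leading term, which gives
  uniqueness. Conversely, the remainder after the greedy choice of the leading term is small enough
  that its own representation respects the spacing.\<close>

section \<open>Extremal sums with spacing \<open>2 * k + 2\<close>\<close>

lemma skipponacci_nonneg: "skipponacci k n \<ge> 0"
proof (induction n rule: less_induct)
  case (less n)
  then show ?case
    by (subst skipponacci.simps) auto
qed

text \<open>Natural subtraction truncates at 0, so the sum stops once the index would drop below
  1.\<close>

function max_rep :: "nat \<Rightarrow> nat \<Rightarrow> int" where
  "max_rep k n = (if n = 0 then 0 else skipponacci k n + max_rep k (n - (2 * k + 2)))"
  by auto
termination by (relation "measure snd") auto

declare max_rep.simps [simp del]

lemma max_rep_0 [simp]: "max_rep k 0 = 0"
  by (subst max_rep.simps) simp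

lemma max_rep_rec: "max_rep k n = skipponacci k n + max_rep k (n - (2 * k + 2))"
proof (cases "n = 0")
  case False
  then show ?thesis by (subst max_rep.simps) simp
qed (simp add: skipponacci_0)

lemma max_rep_nonneg: "max_rep k n \<ge> 0"
proof (induction n rule: less_induct)
  case (less n)
  then show ?case
    by (subst max_rep.simps) (auto intro!: add_nonneg_nonneg skipponacci_nonneg)
qed

lemma skipponacci_small: "n \<le> k + 1 \<Longrightarrow> skipponacci k n = int n"
  by (simp add: skipponacci.simps)

lemma max_rep_small: "n \<le> 2 * k + 2 \<Longrightarrow> max_rep k n = skipponacci k n"
  by (subst max_rep_rec) simp

text \<open>Applying the recurrence twice splits the number at \<open>n\<close> into those at
  \<open>n - 1\<close>, \<open>n - (k + 2)\<close> and \<open>n - (2 * k + 2)\<close>. The induction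
  hypothesis turns the last into the tails of the two \<open>max_rep\<close> sums, plus 1.\<close>

lemma skipponacci_eq_max_rep:
  "n \<ge> 1 \<Longrightarrow> skipponacci k n = max_rep k (n - 1) + max_rep k (n - (k + 2)) + 1"
proof (induction n rule: less_induct)
  case (less n)
  show ?case
  \<comment> \<open>Up to this threshold both \<open>max_rep\<close> sums have at most one nonzero
    term; beyond it \<open>n - (2 * k + 2)\<close> is positive, as the induction hypothesis
    requires.\<close>
  proof (cases "n \<le> 2 * k + 2")
    case True
    then have "max_rep k (n - 1) = skipponacci k (n - 1)"
      and "max_rep k (n - (k + 2)) = int (n - (k + 2))"
      by (simp_all add: max_rep_small skipponacci_small)
    moreover have "skipponacci k n = skipponacci k (n - 1) + int (n - (k + 2)) + 1"
    proof (cases "n \<le> k + 1")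
      case True
      then show ?thesis using less.prems
        by (simp add: skipponacci_small)
    next
      case False
      then show ?thesis using True
        by (simp add: skipponacci.simps[of k n] skipponacci_small)
    qed
    ultimately show ?thesis by simp
  next
    case False
    have "skipponacci k n = skipponacci k (n - 1) + skipponacci k (n - (k + 1))"
      using False by (subst skipponacci.simps) simp
    also have "skipponacci k (n - (k + 1)) =
        skipponacci k (n - (k + 2)) + skipponacci k (n - (2 * k + 2))"
    proof -
      have "n - (k + 1) - 1 = n - (k + 2)" "n - (k + 1) - 1 - k = n - (2 * k + 2)" by auto
      with False show ?thesis by (subst skipponacci.simps) (simp add: skipponacci_0)
    qed
    also have "skipponacci k (n - (2 * k + 2)) =
        max_rep k (n - 1 - (2 * k + 2)) + max_rep k (n - (k + 2) - (2 * k + 2)) + 1"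
    proof -
      have "n - (2 * k + 2) - 1 = n - 1 - (2 * k + 2)"
        "n - (2 * k + 2) - (k + 2) = n - (k + 2) - (2 * k + 2)" by auto
      with False less.IH[of "n - (2 * k + 2)"] show ?thesis by simp
    qed
    finally show ?thesis
      using max_rep_rec[of k "n - 1"] max_rep_rec[of k "n - (k + 2)"] by simp
  qed
qed

lemma strict_mono_max_rep: "strict_mono (max_rep k)"
  unfolding strict_mono_Suc_iff
proof
  fix n
  show "max_rep k n < max_rep k (Suc n)"
    using skipponacci_eq_max_rep[of "Suc n" k] max_rep_rec[of k "Suc n"]
      max_rep_nonneg[of k "Suc n - (k + 2)"] max_rep_nonneg[of k "Suc n - (2 * k + 2)"]
    by simp
qed

lemma max_rep_less_iff [simp]: "max_rep k m < max_rep k n \<longleftrightarrow> m < n"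
  by (rule strict_mono_less[OF strict_mono_max_rep])

lemma max_rep_le_iff [simp]: "max_rep k m \<le> max_rep k n \<longleftrightarrow> m \<le> n"
  by (rule strict_mono_less_eq[OF strict_mono_max_rep])

text \<open>Strictly increasing integers starting at 0. This unboundedness makes the least index in
  the existence proof well defined.\<close>

lemma max_rep_ge: "int n \<le> max_rep k n"
proof (induction n)
  case (Suc n)
  have "max_rep k n < max_rep k (Suc n)" by simp
  with Suc show ?case by linarith
qed simp

text \<open>Once the largest index \<open>m\<close> is split off, the others are at most
  \<open>m - (2 * k + 2)\<close>, which matches the recursion of \<open>max_rep\<close>.\<close>

lemma sum_skipponacci_le_max_rep:
  assumes "finite P" "\<And>m n. m \<in> P \<Longrightarrow> n \<in> P \<Longrightarrow> m < n \<Longrightarrow> m + (2 * k + 2) \<le> n"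
    and "\<And>m. m \<in> P \<Longrightarrow> m \<le> n"
  shows "sum (skipponacci k) P \<le> max_rep k n"
  using assms
proof (induction P arbitrary: n rule: finite_linorder_max_induct)
  case empty
  then show ?case by (simp add: max_rep_nonneg)
next
  case (insert m P)
  have "sum (skipponacci k) P \<le> max_rep k (m - (2 * k + 2))"
  proof (rule insert.IH)
    fix j assume "j \<in> P"
    with insert.hyps(2) insert.prems(1)[of j m] show "j \<le> m - (2 * k + 2)" by auto
  qed (use insert.prems in auto)
  moreover have "m \<notin> P" using insert.hyps(2) by blast
  ultimately have "sum (skipponacci k) (insert m P) \<le> max_rep k m"
    using insert.hyps(1) max_rep_rec[of k m] by simp
  also have "\<dots> \<le> max_rep k n" using insert.prems(2) by simp
  finally show ?case .
qed

section \<open>Basic facts and bounds for representations\<close>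

lemma far_difference_rep_sign:
  "far_difference_rep k x R \<Longrightarrow> (e, n) \<in> R \<Longrightarrow> e = -1 \<or> e = 1"
  by (auto simp: far_difference_rep_def)

lemma far_difference_rep_pos: "far_difference_rep k x R \<Longrightarrow> (e, n) \<in> R \<Longrightarrow> n \<ge> 1"
  by (auto simp: far_difference_rep_def)

lemma far_difference_rep_index_unique:
  "far_difference_rep k x R \<Longrightarrow> (e, n) \<in> R \<Longrightarrow> (f, n) \<in> R \<Longrightarrow> e = f"
  by (force simp: far_difference_rep_def inj_on_def)

lemma far_difference_rep_finite: "far_difference_rep k x R \<Longrightarrow> finite R"
  by (simp add: far_difference_rep_def)

lemma well_spaced_same:
  "well_spaced k R \<Longrightarrow> (e, m) \<in> R \<Longrightarrow> (e, n) \<in> R \<Longrightarrow> m < n \<Longrightarrow> m + (2 * k + 2) \<le> n"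
  by (fastforce simp: well_spaced_def)

lemma well_spaced_opposite:
  "well_spaced k R \<Longrightarrow> (e, m) \<in> R \<Longrightarrow> (f, n) \<in> R \<Longrightarrow> e \<noteq> f \<Longrightarrow> m < n \<Longrightarrow> m + (k + 2) \<le> n"
  by (fastforce simp: well_spaced_def)

lemma well_spaced_subset: "well_spaced k R \<Longrightarrow> Q \<subseteq> R \<Longrightarrow> well_spaced k Q"
  unfolding well_spaced_def by blast

lemma far_difference_rep_remove:
  assumes "far_difference_rep k x R" "(e, n) \<in> R"
  shows "far_difference_rep k (x - e * skipponacci k n) (R - {(e, n)})"
  using assms by (auto simp: far_difference_rep_def sum_diff1 intro: inj_on_subset)

lemma far_difference_rep_insert:
  assumes "far_difference_rep k x R" "e \<in> {-1, 1}" "n \<ge> 1" "\<And>f m. (f, m) \<in> R \<Longrightarrow> m \<noteq> n"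
  shows "far_difference_rep k (x + e * skipponacci k n) (insert (e, n) R)"
proof -
  have "(e, n) \<notin> R" "n \<notin> snd ` R" using assms(4) by fastforce+
  with assms show ?thesis by (auto simp: far_difference_rep_def)
qed

text \<open>Only the terms of sign \<open>e\<close> contribute positively to \<open>e * x\<close>, so their indices alone
  bound it.\<close>

lemma far_difference_rep_le:
  assumes rep: "far_difference_rep k x R" and ws: "well_spaced k R" and e: "e \<in> {-1, 1}"
    and le: "\<And>m. (e, m) \<in> R \<Longrightarrow> m \<le> n"
  shows "e * x \<le> max_rep k n"
proof -
  have fin: "finite R" and inj: "inj_on snd R" using rep by (simp_all add: far_difference_rep_def)
  let ?Q = "{p \<in> R. fst p = e}"
  have "e * x = (\<Sum>p\<in>R. e * (fst p * skipponacci k (snd p)))"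
    using rep by (simp add: far_difference_rep_def sum_distrib_left case_prod_unfold)
  also have "\<dots> \<le> (\<Sum>p\<in>R. if fst p = e then skipponacci k (snd p) else 0)"
  proof (rule sum_mono)
    fix p assume "p \<in> R"
    then have "fst p = -1 \<or> fst p = 1" using far_difference_rep_sign[OF rep] by (cases p) auto
    then show "e * (fst p * skipponacci k (snd p)) \<le> (if fst p = e then skipponacci k (snd p) else 0)"
      using e skipponacci_nonneg[of k "snd p"] by auto
  qed
  also have "\<dots> = (\<Sum>p\<in>?Q. skipponacci k (snd p))"
    using fin by (simp add: sum.If_cases Int_def)
  also have "\<dots> = sum (skipponacci k) (snd ` ?Q)"
    by (subst sum.reindex) (auto intro: inj_on_subset[OF inj])
  also have "\<dots> \<le> max_rep k n"
    using fin le by (intro sum_skipponacci_le_max_rep) (auto dest: well_spaced_same[OF ws])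
  finally show ?thesis .
qed

text \<open>The upper bound counts the terms of sign \<open>e\<close>. For the lower bound, the
  leading term is removed: terms of sign \<open>- e\<close> have index at most
  \<open>n - (k + 2)\<close>, so they lower the value by at most
  \<open>max_rep k (n - (k + 2))\<close>, and the identity for \<open>skipponacci k n\<close> leaves
  more than \<open>max_rep k (n - 1)\<close>.\<close>

lemma far_difference_rep_leading:
  assumes rep: "far_difference_rep k x R" and ws: "well_spaced k R" and lead: "(e, n) \<in> R"
    and le: "\<forall>p\<in>R. snd p \<le> n"
  shows "max_rep k (n - 1) < e * x" "e * x \<le> max_rep k n"
proof -
  have e: "e \<in> {-1, 1}" using far_difference_rep_sign[OF rep lead] by auto
  show "e * x \<le> max_rep k n" using le by (intro far_difference_rep_le[OF rep ws e]) auto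
  have "(- e) * (x - e * skipponacci k n) \<le> max_rep k (n - (k + 2))"
  proof (rule far_difference_rep_le[OF far_difference_rep_remove[OF rep lead]])
    show "well_spaced k (R - {(e, n)})" using ws by (rule well_spaced_subset) blast
    fix m assume "(- e, m) \<in> R - {(e, n)}"
    then have m: "(- e, m) \<in> R" by blast
    moreover have "- e \<noteq> e" using e by auto
    moreover have "m \<noteq> n"
      using far_difference_rep_index_unique[OF rep lead, of "- e"] m \<open>- e \<noteq> e\<close> by auto
    ultimately show "m \<le> n - (k + 2)"
      using well_spaced_opposite[OF ws m lead] bspec[OF le m] by auto
  qed (use e in auto)
  then have "skipponacci k n - e * x \<le> max_rep k (n - (k + 2))"
    using e by auto
  then show "max_rep k (n - 1) < e * x"
    using skipponacci_eq_max_rep[OF far_difference_rep_pos[OF rep lead], of k] by linarith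
qed

section \<open>Uniqueness from the leading term\<close>

lemma far_difference_rep_obtain_leading:
  assumes "far_difference_rep k x R" "R \<noteq> {}"
  obtains e n where "(e, n) \<in> R" "\<forall>p\<in>R. snd p \<le> n"
proof -
  have fin: "finite (snd ` R)" using assms by (simp add: far_difference_rep_def)
  have "Max (snd ` R) \<in> snd ` R" using fin assms(2) by (intro Max_in) auto
  then obtain e where "(e, Max (snd ` R)) \<in> R" by force
  moreover have "\<forall>p\<in>R. snd p \<le> Max (snd ` R)"
    using fin by simp
  ultimately show thesis using that by blast
qed

lemma far_difference_rep_empty_iff:
  assumes "far_difference_rep k x R" "well_spaced k R"
  shows "R = {} \<longleftrightarrow> x = 0"
proof
  assume "x = 0"
  show "R = {}"
  proof (rule ccontr)
    assume "R \<noteq> {}"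
    then obtain e n where lead: "(e, n) \<in> R" "\<forall>p\<in>R. snd p \<le> n"
      using far_difference_rep_obtain_leading[OF assms(1)] by blast
    show False
      using far_difference_rep_leading(1)[OF assms lead] max_rep_nonneg[of k "n - 1"] \<open>x = 0\<close>
      by simp
  qed
qed (use assms in \<open>simp add: far_difference_rep_def\<close>)

text \<open>Both representations have the same leading term; removing it from each gives
  representations of one remainder with fewer terms.\<close>

lemma far_difference_rep_unique:
  assumes "far_difference_rep k x A" "well_spaced k A"
    and "far_difference_rep k x B" "well_spaced k B"
  shows "A = B"
  using assms
proof (induction "card A" arbitrary: x A B rule: less_induct)
  case less
  show ?case
  proof (cases "A = {}")
    case True
    then show ?thesis
      using far_difference_rep_empty_iff less.prems by metis
  next
    case False
    then have "B \<noteq> {}" using far_difference_rep_empty_iff less.prems by metis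
    from False obtain e n where A: "(e, n) \<in> A" "\<forall>p\<in>A. snd p \<le> n"
      using far_difference_rep_obtain_leading[OF less.prems(1)] by blast
    from \<open>B \<noteq> {}\<close> obtain e' n' where B: "(e', n') \<in> B" "\<forall>p\<in>B. snd p \<le> n'"
      using far_difference_rep_obtain_leading[OF less.prems(3)] by blast
    note bA = far_difference_rep_leading[OF less.prems(1,2) A]
    note bB = far_difference_rep_leading[OF less.prems(3,4) B]
    \<comment> \<open>Both \<open>e * x\<close> and \<open>e' * x\<close> are positive, so both
      signs are that of \<open>x\<close>.\<close>
    have "e = e'"
      using far_difference_rep_sign[OF less.prems(1) A(1)]
        far_difference_rep_sign[OF less.prems(3) B(1)] bA(1) bB(1)
        max_rep_nonneg[of k "n - 1"] max_rep_nonneg[of k "n' - 1"] by auto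
    \<comment> \<open>Both intervals contain \<open>e * x\<close>, so by monotonicity their indices
      agree.\<close>
    have "max_rep k (n - 1) < max_rep k n'" "max_rep k (n' - 1) < max_rep k n"
      using bA bB unfolding \<open>e = e'\<close> by linarith+
    then have "n = n'" by simp
    have "A - {(e, n)} = B - {(e, n)}"
    proof (rule less.hyps)
      show "card (A - {(e, n)}) < card A"
        using A(1) far_difference_rep_finite[OF less.prems(1)] by (intro card_Diff1_less)
      show "far_difference_rep k (x - e * skipponacci k n) (A - {(e, n)})"
        using less.prems(1) A(1) by (rule far_difference_rep_remove)
      show "far_difference_rep k (x - e * skipponacci k n) (B - {(e, n)})"
        using less.prems(3) B(1) unfolding \<open>e = e'\<close> \<open>n = n'\<close> by (rule far_difference_rep_remove)
    qed (use less.prems well_spaced_subset in blast)+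
    then show ?thesis using A(1) B(1) \<open>e = e'\<close> \<open>n = n'\<close> by blast
  qed
qed

section \<open>Existence by greedy choice\<close>

lemma well_spaced_insert:
  assumes "well_spaced k R"
    and "\<And>m. (e, m) \<in> R \<Longrightarrow> m + (2 * k + 2) \<le> n"
    and "\<And>f m. (f, m) \<in> R \<Longrightarrow> m + (k + 2) \<le> n"
  shows "well_spaced k (insert (e, n) R)"
  using assms unfolding well_spaced_def by fastforce

lemma far_difference_rep_exists: "\<exists>R. far_difference_rep k x R \<and> well_spaced k R"
proof (induction "nat \<bar>x\<bar>" arbitrary: x rule: less_induct)
  case less
  show ?case
  proof (cases "x = 0")
    case True
    then have "far_difference_rep k x {} \<and> well_spaced k {}"
      by (simp add: far_difference_rep_def well_spaced_def)
    then show ?thesis ..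
  next
    case False
    define e where "e = sgn x"
    have e: "e \<in> {-1, 1}" and ex: "e * x = \<bar>x\<bar>"
      using False by (auto simp: e_def sgn_if)
    \<comment> \<open>Minimality puts \<open>\<bar>x\<bar>\<close> in the interval belonging to
      leading index \<open>n\<close>.\<close>
    define n where "n = (LEAST n. \<bar>x\<bar> \<le> max_rep k n)"
    have "\<bar>x\<bar> \<le> max_rep k (nat \<bar>x\<bar>)" using max_rep_ge[of "nat \<bar>x\<bar>" k] by simp
    then have upper: "\<bar>x\<bar> \<le> max_rep k n" unfolding n_def by (rule LeastI)
    have "n \<noteq> 0" using upper False by (intro notI) simp
    then have n: "n \<ge> 1" "n - 1 < n" by auto
    have lower: "max_rep k (n - 1) < \<bar>x\<bar>"
      using not_less_Least[of "n - 1" "\<lambda>n. \<bar>x\<bar> \<le> max_rep k n"] n by (simp add: n_def)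
    define y where "y = x - e * skipponacci k n"
    have ey: "e * y = \<bar>x\<bar> - skipponacci k n"
    proof -
      have "e * e = 1" using e by auto
      then show ?thesis by (simp add: y_def right_diff_distrib ex flip: mult.assoc)
    qed
    \<comment> \<open>The two bounds on the remainder correspond to the two spacings: the first
      limits a leading term of sign \<open>e\<close>, the second one of sign
      \<open>- e\<close>.\<close>
    have y_upper: "e * y \<le> max_rep k (n - (2 * k + 2))"
      using ey upper max_rep_rec[of k n] by linarith
    have y_lower: "- e * y \<le> max_rep k (n - (k + 2))"
      using ey lower skipponacci_eq_max_rep[OF n(1), of k] by simp
    \<comment> \<open>The remainder shrinks either way: \<open>e * y\<close> lies below
      \<open>\<bar>x\<bar>\<close> as the subtracted number is positive, and \<open>- e * y\<close>
      is at most \<open>max_rep k (n - 1)\<close>, hence below \<open>\<bar>x\<bar>\<close>.\<close>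
    have "max_rep k (n - (k + 2)) \<le> max_rep k (n - 1)" by simp
    moreover have "skipponacci k n > 0"
      using skipponacci_eq_max_rep[OF n(1), of k] max_rep_nonneg[of k "n - 1"]
        max_rep_nonneg[of k "n - (k + 2)"] by linarith
    moreover have "\<bar>y\<bar> = \<bar>e * y\<bar>" using e by auto
    ultimately have "\<bar>y\<bar> < \<bar>x\<bar>" using ey y_lower lower by linarith
    then have "nat \<bar>y\<bar> < nat \<bar>x\<bar>" by simp
    from less[OF this] obtain R where R: "far_difference_rep k y R" "well_spaced k R" by blast
    \<comment> \<open>The bounds on \<open>y\<close> control only the leading index \<open>m\<close>
      of \<open>R\<close>; the other terms are handled by \<open>j \<le> m\<close> and the spacing
      inside \<open>R\<close>. The second conjunct, for both signs, also keeps \<open>n\<close>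
      above every old index.\<close>
    have gap: "(f = e \<longrightarrow> j + (2 * k + 2) \<le> n) \<and> j + (k + 2) \<le> n" if j: "(f, j) \<in> R" for f j
    proof -
      obtain e' m where lead: "(e', m) \<in> R" "\<forall>p\<in>R. snd p \<le> m"
        using far_difference_rep_obtain_leading[OF R(1)] j by blast
      have "j \<le> m" using bspec[OF lead(2) j] by simp
      note pos = far_difference_rep_leading(1)[OF R lead]
      have m: "m \<ge> 1" using far_difference_rep_pos[OF R(1) lead(1)] .
      consider "e' = e" | "e' = - e"
        using e far_difference_rep_sign[OF R(1) lead(1)] by auto
      then show ?thesis
      proof cases
        case 1
        then have "max_rep k (m - 1) < max_rep k (n - (2 * k + 2))"
          using pos y_upper by (blast intro: less_le_trans)
        \<comment> \<open>The strict inequality makes \<open>n - (2 * k + 2)\<close> positive, so no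
          truncation occurs.\<close>
        then have "m + (2 * k + 2) \<le> n" using m by simp
        with \<open>j \<le> m\<close> show ?thesis by simp
      next
        case 2
        then have "max_rep k (m - 1) < max_rep k (n - (k + 2))"
          using pos y_lower by (blast intro: less_le_trans)
        then have mn: "m + (k + 2) \<le> n" using m by simp
        \<comment> \<open>A term of sign \<open>e\<close> lies below the opposite leading term, so
          two gaps of \<open>k + 2\<close> add up to more than \<open>2 * k + 2\<close>.\<close>
        moreover have "j + (k + 2) \<le> m" if "f = e"
        proof -
          have "f \<noteq> e'" using that 2 e by auto
          moreover from this have "j \<noteq> m"
            using far_difference_rep_index_unique[OF R(1) lead(1), of f] j by auto
          ultimately show ?thesis
            using well_spaced_opposite[OF R(2) j lead(1)] \<open>j \<le> m\<close> by linarith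
        qed
        ultimately show ?thesis using \<open>j \<le> m\<close> by auto
      qed
    qed
    have "far_difference_rep k (y + e * skipponacci k n) (insert (e, n) R)"
      using R(1) e n(1) by (rule far_difference_rep_insert) (auto dest: gap)
    moreover have "well_spaced k (insert (e, n) R)"
      using R(2) by (rule well_spaced_insert) (auto dest: gap)
    moreover have "y + e * skipponacci k n = x" by (simp add: y_def)
    ultimately show ?thesis by metis
  qed
qed

theorem theorem1p6:
  fixes k :: nat and x :: int
  shows "\<exists>!R. far_difference_rep k x R \<and> well_spaced k R"
  using far_difference_rep_exists far_difference_rep_unique by blast

end
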